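(* Let $\mathbb{X}=(X,g,\xi)$ be a gm-space with $X\subset\mathbb{R}^d$ closed and convex, and let $n\in\mathbb{N}$, $n\ge1$. Set $\bar m_\xi:=\int_X x\,\mathrm{d}\xi(x)$ and $\Sigma_\xi:=\int_X(x-\bar m_\xi)(x-\bar m_\xi)^\top\,\mathrm{d}\xi(x)$. Let $\mathrm{q}_n^{\mathrm W}(\xi)$ be the Wasserstein quantization value with respect to the standard Euclidean metric. (i) If $\int_X\|x\|^4\,\mathrm{d}\xi(x)<\infty$ and $g(x,x')=\|x-x'\|^2$, then $$\mathrm{q}_n^{\mathrm{GW}}(\mathbb{X})\ge 2\sqrt{\lambda_{\min}(\Sigma_\xi)}\cdot\mathrm{q}_n^{\mathrm W}(\xi).$$ (ii) If $X$ is bounded and $g(x,x')=\|x-x'\|$, then $$\mathrm{q}_n^{\mathrm{GW}}(\mathbb{X})\ge\frac{\sqrt{\lambda_{\min}(\Sigma_\xi)}}{\operatorname{diam}(X)}\cdot\mathrm{q}_n^{\mathrm W}(\xi).$$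
   Context: A gauged measure space (gm-space) is a triple $(X,g,\xi)$ where $X$ is a Polish space, $\xi$ is a Borel probability measure on $X$, and the gauge $g\in L^2(X\times X,\xi\otimes\xi)$ is symmetric. For gm-spaces $\mathbb{X}=(X,g,\xi)$ and $\mathbb{Y}=(Y,h,\upsilon)$, with $\Pi(\xi,\upsilon)$ the set of couplings of $\xi$ and $\upsilon$, $$\mathrm{GW}_2(\mathbb{X},\mathbb{Y})=\inf_{\pi\in\Pi(\xi,\upsilon)}\Big(\iint_{(X\times Y)^2}|g(x,x')-h(y,y')|^2\,\mathrm{d}\pi(x,y)\,\mathrm{d}\pi(x',y')\Big)^{1/2}.$$ Write $[n]=\{1,\dots,n\}$. $\mathfrak{GM}_n$ is the set of gm-spaces $([n],G,\upsilon)$ with $G\in\mathbb{R}^{n\times n}$ symmetric (viewed as the gauge $(i,i')\mapsto G_{i,i'}$) and $\upsilon$ a probability measure on $[n]$; $\mathrm{q}_n^{\mathrm{GW}}(\mathbb{X}):=\inf_{\mathbb{Y}\in\mathfrak{GM}_n}\mathrm{GW}_2(\mathbb{X},\mathbb{Y})$. $\mathcal{P}_n(X)=\{\sum_{i=1}^n\upsilon_i\delta_{y_i}:y_i\in X,\ \upsilon_i\ge0,\ \sum_i\upsilon_i=1\}$, $\mathrm{W}_2(\xi,\upsilon)=\inf_{\pi\in\Pi(\xi,\upsilon)}\big(\int\|x-y\|^2\,\mathrm{d}\pi(x,y)\big)^{1/2}$, and $\mathrm{q}_n^{\mathrm W}(\xi):=\inf_{\upsilon\in\mathcal{P}_n(X)}\mathrm{W}_2(\xi,\upsilon)$.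 $\|\cdot\|$ is the Euclidean norm, $\lambda_{\min}(M)$ the smallest eigenvalue of a positive semi-definite matrix $M$, and $\operatorname{diam}(X)=\sup_{x,x'\in X}\|x-x'\|$. *)

theory Defs
  imports "HOL-Probability.Probability"
begin

definition polish_topology :: "'a topology \<Rightarrow> bool" where
  "polish_topology T \<longleftrightarrow> completely_metrizable_space T \<and> separable_space T"

definition borel_of :: "'a topology \<Rightarrow> 'a measure" where
  "borel_of T = sigma (topspace T) {U. openin T U}"

text \<open>
  The topology carries the underlying set of the space as its topspace. The gauge is a
  representative of an \<open>L\<^sup>2\<close> class, so its values off the topspace are irrelevant and symmetry
  is required almost everywhere.
\<close>

type_synonym 'a gm_triple = "'a topology \<times> ('a \<Rightarrow> 'a \<Rightarrow> real) \<times> 'a measure"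

fun gm_space :: "'a gm_triple \<Rightarrow> bool" where
  "gm_space (T, g, \<xi>) \<longleftrightarrow>
     polish_topology T \<and>
     prob_space \<xi> \<and> sets \<xi> = sets (borel_of T) \<and>
     (\<lambda>(x, x'). g x x') \<in> borel_measurable (\<xi> \<Otimes>\<^sub>M \<xi>) \<and>
     integrable (\<xi> \<Otimes>\<^sub>M \<xi>) (\<lambda>(x, x'). (g x x')\<^sup>2) \<and>
     (AE (x, x') in \<xi> \<Otimes>\<^sub>M \<xi>. g x x' = g x' x)"

definition couplings :: "'a measure \<Rightarrow> 'b measure \<Rightarrow> ('a \<times> 'b) measure set" where
  "couplings \<xi> \<upsilon> =
     {\<pi>. sets \<pi> = sets (\<xi> \<Otimes>\<^sub>M \<upsilon>) \<and> distr \<pi> \<xi> fst = \<xi> \<and> distr \<pi> \<upsilon> snd = \<upsilon>}"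

definition ennsqrt :: "ennreal \<Rightarrow> ennreal" where
  "ennsqrt a = (if a = \<infinity> then \<infinity> else ennreal (sqrt (enn2real a)))"

fun GW2 :: "'a gm_triple \<Rightarrow> 'b gm_triple \<Rightarrow> ennreal" where
  "GW2 (S, g, \<xi>) (T, h, \<upsilon>) =
     (INF \<pi>\<in>couplings \<xi> \<upsilon>. ennsqrt (\<integral>\<^sup>+(x, y). (\<integral>\<^sup>+(x', y').
        ennreal (\<bar>g x x' - h y y'\<bar>\<^sup>2) \<partial>\<pi>) \<partial>\<pi>))"

text \<open>
  A real \<open>n \<times> n\<close> matrix is a function on index pairs of which only the entries with both
  indices in \<open>{1..n}\<close> matter.
\<close>

definition GM :: "nat \<Rightarrow> nat gm_triple set" where
  "GM n = {(discrete_topology {1..n}, G, \<upsilon>) | G \<upsilon>.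
     (\<forall>i\<in>{1..n}. \<forall>j\<in>{1..n}. G i j = G j i) \<and>
     prob_space \<upsilon> \<and> sets \<upsilon> = Pow {1..n}}"

lemma GM_gm_space:
  assumes "\<Y> \<in> GM n"
  shows "gm_space \<Y>"
proof -
  obtain G \<upsilon> where Y: "\<Y> = (discrete_topology {1..n}, G, \<upsilon>)"
    and sym: "\<forall>i\<in>{1..n}. \<forall>j\<in>{1..n}. G i j = G j i"
    and prob: "prob_space \<upsilon>" and sets: "sets \<upsilon> = Pow {1..n}"
    using assms unfolding GM_def by auto
  interpret prob_space \<upsilon> by (fact prob)
  interpret P: pair_prob_space \<upsilon> \<upsilon> ..
  have "sets \<upsilon> = sets (count_space {1..n})"
    using sets by simp
  then have "sets (\<upsilon> \<Otimes>\<^sub>M \<upsilon>) = sets (count_space {1..n} \<Otimes>\<^sub>M count_space {1..n})"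
    by (intro sets_pair_measure_cong)
  then have pair: "sets (\<upsilon> \<Otimes>\<^sub>M \<upsilon>) = sets (count_space ({1..n} \<times> {1..n}))"
    by (simp only: pair_measure_countable[OF countable_finite countable_finite] finite_atLeastAtMost)
  then have meas: "f \<in> borel_measurable (\<upsilon> \<Otimes>\<^sub>M \<upsilon>)" for f :: "nat \<times> nat \<Rightarrow> real"
    by (subst measurable_cong_sets[OF pair refl]) simp
  have space: "space (\<upsilon> \<Otimes>\<^sub>M \<upsilon>) = {1..n} \<times> {1..n}"
    using sets_eq_imp_space_eq[OF pair] by simp
  have "integrable (\<upsilon> \<Otimes>\<^sub>M \<upsilon>) (\<lambda>(i, j). (G i j)\<^sup>2)"
  proof (rule P.integrable_const_bound)
    show "AE p in \<upsilon> \<Otimes>\<^sub>M \<upsilon>. norm (case p of (i, j) \<Rightarrow> (G i j)\<^sup>2)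
        \<le> (\<Sum>(i, j)\<in>{1..n} \<times> {1..n}. (G i j)\<^sup>2)"
    proof (rule AE_I2)
      fix p assume "p \<in> space (\<upsilon> \<Otimes>\<^sub>M \<upsilon>)"
      then have "p \<in> {1..n} \<times> {1..n}"
        by (simp add: space)
      then have "(case p of (i, j) \<Rightarrow> (G i j)\<^sup>2) \<le> (\<Sum>(i, j)\<in>{1..n} \<times> {1..n}. (G i j)\<^sup>2)"
        by (intro member_le_sum) auto
      then show "norm (case p of (i, j) \<Rightarrow> (G i j)\<^sup>2) \<le> (\<Sum>(i, j)\<in>{1..n} \<times> {1..n}. (G i j)\<^sup>2)"
        by (cases p) simp
    qed
  qed (rule meas)
  moreover have "AE (i, j) in \<upsilon> \<Otimes>\<^sub>M \<upsilon>. G i j = G j i"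
    using sym by (intro AE_I2) (auto simp: space)
  moreover have "sets (borel_of (discrete_topology {1..n})) = Pow {1..n}"
    by (simp add: borel_of_def Pow_def[symmetric] sigma_algebra.sigma_sets_eq[OF sigma_algebra_Pow])
  moreover have "polish_topology (discrete_topology {1..n})"
    unfolding polish_topology_def
    by (simp add: completely_metrizable_space_discrete_topology second_countable_imp_separable_space
        second_countable_discrete_topology)
  ultimately show ?thesis
    using Y prob sets meas by simp
qed

definition qGW :: "nat \<Rightarrow> 'a gm_triple \<Rightarrow> ennreal" where
  "qGW n \<X> = (INF \<Y>\<in>GM n. GW2 \<X> \<Y>)"

definition Pn :: "nat \<Rightarrow> 'a::topological_space set \<Rightarrow> 'a measure set" where
  "Pn n X = {\<upsilon>. sets \<upsilon> = sets (borel_of (top_of_set X)) \<and>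
     (\<exists>y w. (\<forall>i\<in>{1..n}. y i \<in> X \<and> 0 \<le> (w i :: real)) \<and> (\<Sum>i=1..n. w i) = 1 \<and>
        (\<forall>A\<in>sets \<upsilon>. emeasure \<upsilon> A =
           (\<Sum>i=1..n. ennreal (w i) * emeasure (return (borel_of (top_of_set X)) (y i)) A)))}"

definition W2 :: "'a::real_normed_vector measure \<Rightarrow> 'a measure \<Rightarrow> ennreal" where
  "W2 \<xi> \<upsilon> =
     (INF \<pi>\<in>couplings \<xi> \<upsilon>. ennsqrt (\<integral>\<^sup>+(x, y). ennreal ((norm (x - y))\<^sup>2) \<partial>\<pi>))"

definition qW :: "nat \<Rightarrow> 'a::real_normed_vector set \<Rightarrow> 'a measure \<Rightarrow> ennreal" where
  "qW n X \<xi> = (INF \<upsilon>\<in>Pn n X. W2 \<xi> \<upsilon>)"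

definition mean_vec :: "(real ^ 'd) measure \<Rightarrow> real ^ 'd" where
  "mean_vec \<xi> = (\<integral>x. x \<partial>\<xi>)"

definition cov_matrix :: "(real ^ 'd) measure \<Rightarrow> real ^ 'd ^ 'd" where
  "cov_matrix \<xi> = (\<chi> i j. \<integral>x. (x - mean_vec \<xi>) $ i * (x - mean_vec \<xi>) $ j \<partial>\<xi>)"

definition eigenvalue_of :: "real ^ 'd ^ 'd \<Rightarrow> real \<Rightarrow> bool" where
  "eigenvalue_of M c \<longleftrightarrow> (\<exists>v. v \<noteq> 0 \<and> M *v v = c *\<^sub>R v)"

text \<open>Only meaningful for symmetric \<open>M\<close>, where a least eigenvalue exists.\<close>

definition lambda_min :: "real ^ 'd ^ 'd \<Rightarrow> real" where
  "lambda_min M = (LEAST c. eigenvalue_of M c)"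

end

theory Submission
  imports Defs
begin

text \<open>
  Let \<open>(x, y)\<close> and \<open>(x', y')\<close> be two independent draws from a coupling of the given law with a law on
  \<open>n\<close> labels, and let \<open>G\<close> be a matrix. For squared distances, the cost is the second moment of
  \<open>|x - x'|\<^sup>2 - G y y'\<close>. Fix \<open>(x, y)\<close> and regard this as a function of \<open>(x', y')\<close>. Among all functions of
  \<open>y'\<close>, the conditional mean is the best approximation of \<open>|x - x'|\<^sup>2\<close>, so the second moment is at
  least that of \<open>V - 2 (U \<bullet> x)\<close>, where \<open>U = x' - E[x' | y']\<close> and \<open>V = |x'|\<^sup>2 - E[|x'|\<^sup>2 | y']\<close>
  (\<open>integral_square_le_of_orthogonal\<close>).

  Now fix \<open>(x', y')\<close> instead and average over \<open>x\<close>. A second moment is at least a variance, and the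
  variance of \<open>2 (U \<bullet> x)\<close> is \<open>4 (U \<bullet> \<Sigma> U)\<close>, which is at least \<open>4 \<lambda>\<^sub>m\<^sub>i\<^sub>n(\<Sigma>) |U|\<^sup>2\<close>
  (\<open>affine_second_moment_lower_bound\<close>, \<open>least_rayleigh_value\<close>). Averaging over \<open>(x', y')\<close> leaves
  \<open>4 \<lambda>\<^sub>m\<^sub>i\<^sub>n(\<Sigma>)\<close> times the cost of moving every point to the centroid of its cell. The centroids lie in
  \<open>X\<close> because \<open>X\<close> is closed and convex, so this cost is at least the square of the Wasserstein
  quantization value (\<open>qW_le_of_codebook\<close>). Together this is \<open>squared_distance_cost_lower_bound\<close>, which
  gives the first claim.

  For plain distances on a set of diameter \<open>D\<close>, truncate the entries of the matrix to \<open>[0, D]\<close>, which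
  only improves the approximation, and square them. Squaring is \<open>2 D\<close>-Lipschitz on \<open>[0, D]\<close>, so the
  squared matrix approximates the squared distances with an error at most \<open>2 D\<close> times as large, and the
  first claim divided by \<open>2 D\<close> is the second (\<open>distance_cost_lower_bound\<close>).
\<close>

section \<open>The least eigenvalue as minimal Rayleigh quotient\<close>

text \<open>
  The Rayleigh quotient attains its minimum on the compact unit sphere. A minimiser is an
  eigenvector, for otherwise a small step against the residual would decrease the quotient, and
  every eigenvalue is a value of the quotient. So the minimum is the least eigenvalue; in
  particular that least eigenvalue exists.
\<close>

lemma least_rayleigh_value:
  fixes A :: "real ^ 'd ^ 'd"
  assumes sym: "transpose A = A"
  shows "lambda_min A * (norm u)\<^sup>2 \<le> u \<bullet> (A *v u)"
proof -
  define q where "q w = w \<bullet> (A *v w)" for w :: "real ^ 'd"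
  have self_adjoint: "x \<bullet> (A *v y) = y \<bullet> (A *v x)" for x y
    using dot_lmul_matrix[of x A y] sym
    by (metis inner_commute transpose_matrix_vector)
  have "continuous_on (sphere 0 1) q"
    unfolding q_def by (intro continuous_intros matrix_vector_mult_linear_continuous_on)
  moreover have "sphere (0 :: real ^ 'd) 1 \<noteq> {}"
    by simp
  ultimately obtain v where v: "norm v = 1" and least: "\<And>w. norm w = 1 \<Longrightarrow> q v \<le> q w"
    using continuous_attains_inf[OF compact_sphere, of 0 1 q] by auto
  define \<mu> where "\<mu> = q v"
  have lower: "\<mu> * (norm w)\<^sup>2 \<le> q w" for w
  proof (cases "w = 0")
    case False
    have "\<mu> \<le> q ((1 / norm w) *\<^sub>R w)"
      using least[of "(1 / norm w) *\<^sub>R w"] False by (simp add: \<mu>_def)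
    also have "\<dots> = q w / (norm w)\<^sup>2"
      by (simp add: q_def matrix_vector_mult_scaleR power2_eq_square)
    finally show ?thesis
      using False by (simp add: field_simps)
  qed (simp add: q_def)
  have "A *v v = \<mu> *\<^sub>R v"
  proof (rule ccontr)
    define r where "r = A *v v - \<mu> *\<^sub>R v"
    define K where "K = q r - \<mu> * (norm r)\<^sup>2"
    define t where "t = (norm r)\<^sup>2 / (K + 1)"
    assume "A *v v \<noteq> \<mu> *\<^sub>R v"
    then have r: "(norm r)\<^sup>2 > 0"
      by (simp add: r_def)
    have K: "K \<ge> 0"
      using lower[of r] by (simp add: K_def)
    \<comment> \<open>A step of length \<open>t\<close> against the residual \<open>r\<close> changes \<open>q - \<mu> |.|\<^sup>2\<close> by 
      \<open>- 2 t |r|\<^sup>2 + t\<^sup>2 K\<close>, which is negative for the above \<open>t\<close>.\<close>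
    have q_step: "q (v - t *\<^sub>R r) = q v - 2 * t * (r \<bullet> (A *v v)) + t\<^sup>2 * q r"
      using self_adjoint[of v r]
      by (simp add: q_def matrix_vector_mult_diff_distrib matrix_vector_mult_scaleR
          inner_diff_left inner_diff_right power2_eq_square algebra_simps)
    have norm_step: "(norm (v - t *\<^sub>R r))\<^sup>2 = 1 - 2 * t * (r \<bullet> v) + t\<^sup>2 * (norm r)\<^sup>2"
      using v unfolding power2_norm_eq_inner norm_eq_1
      by (simp add: inner_diff_left inner_diff_right power2_eq_square inner_commute algebra_simps)
    have "r \<bullet> (A *v v) = (norm r)\<^sup>2 + \<mu> * (r \<bullet> v)"
      unfolding power2_norm_eq_inner by (subst (3) r_def) (simp add: inner_diff_right)
    then have "q (v - t *\<^sub>R r) - \<mu> * (norm (v - t *\<^sub>R r))\<^sup>2 = - 2 * t * (norm r)\<^sup>2 + t\<^sup>2 * K"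
      unfolding q_step norm_step by (simp add: K_def \<mu>_def algebra_simps)
    then have "2 * t * (norm r)\<^sup>2 \<le> t\<^sup>2 * K"
      using lower[of "v - t *\<^sub>R r"] by linarith
    moreover have "t > 0"
      using r K by (simp add: t_def)
    ultimately have "2 * (norm r)\<^sup>2 \<le> t * K"
      by (simp add: power2_eq_square)
    moreover have "t * K \<le> (norm r)\<^sup>2"
      using K r by (simp add: t_def field_simps)
    ultimately show False
      using r by linarith
  qed
  moreover have "v \<noteq> 0"
    using v by auto
  ultimately have "eigenvalue_of A \<mu>"
    unfolding eigenvalue_of_def by blast
  moreover have "\<mu> \<le> c" if c: "eigenvalue_of A c" for c
  proof -
    obtain w where w: "w \<noteq> 0" "A *v w = c *\<^sub>R w"
      using c unfolding eigenvalue_of_def by blast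
    then have "\<mu> * (norm w)\<^sup>2 \<le> c * (norm w)\<^sup>2"
      using lower[of w] by (simp add: q_def power2_norm_eq_inner)
    then show ?thesis
      using w by simp
  qed
  ultimately have "lambda_min A = \<mu>"
    unfolding lambda_min_def by (rule Least_equality)
  then show ?thesis
    using lower[of u] by (simp add: q_def)
qed

section \<open>Conditional means with respect to finitely many cells\<close>

text \<open>
  A hyperplane strictly separating the centroid from \<open>X\<close> would have all values of \<open>f\<close> strictly on
  one side, and then also their average, which is the centroid itself.
\<close>

lemma centroid_in_closed_convex:
  fixes f :: "'a \<Rightarrow> 'b::euclidean_space"
  assumes "closed X" "convex X"
    and B: "B \<in> sets M" "0 < measure M B"
    and f: "set_integrable M B f" and fX: "\<And>x. x \<in> B \<Longrightarrow> f x \<in> X"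
  shows "(1 / measure M B) *\<^sub>R (LINT x:B|M. f x) \<in> X"
proof (rule ccontr)
  let ?c = "(1 / measure M B) *\<^sub>R (LINT x:B|M. f x)"
  assume "?c \<notin> X"
  then obtain a b where ab: "a \<bullet> ?c < b" "\<And>x. x \<in> X \<Longrightarrow> b < a \<bullet> x"
    using separating_hyperplane_closed_point[of X ?c] assms(1,2) by blast
  have fin: "emeasure M B < \<infinity>"
    using B by (metis emeasure_eq_ennreal_measure ennreal_less_top infinity_ennreal_def
        less_irrefl measure_def enn2real_top top.not_eq_extremum)
  have int: "integrable M (\<lambda>x. indicator B x *\<^sub>R f x)"
    using f by (simp add: set_integrable_def)
  have "b * measure M B = (\<integral>x. indicator B x * b \<partial>M)"
    using B by simp
  also have "\<dots> \<le> (\<integral>x. a \<bullet> (indicator B x *\<^sub>R f x) \<partial>M)"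
  proof (rule integral_mono)
    show "integrable M (\<lambda>x. indicator B x * b)"
      using B fin by simp
    show "integrable M (\<lambda>x. a \<bullet> (indicator B x *\<^sub>R f x))"
      using int by (rule integrable_inner_right)
    show "indicator B x * b \<le> a \<bullet> (indicator B x *\<^sub>R f x)" for x
      using ab(2)[OF fX, of x] by (auto simp: indicator_def)
  qed
  also have "\<dots> = a \<bullet> (LINT x:B|M. f x)"
    unfolding set_lebesgue_integral_def using int by (intro integral_inner_right) auto
  finally show False
    using ab(1) B by (simp add: field_simps)
qed

text \<open>
  Conditional means given an event, in a form that also makes sense for null events: there every
  point of \<open>C\<close> serves, and the conclusion stays inside \<open>C\<close>.
\<close>

lemma exists_centring_point:
  fixes f :: "'a \<Rightarrow> 'b::euclidean_space"
  assumes "finite_measure M" and C: "closed C" "convex C" "C \<noteq> {}"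
    and B [measurable]: "B \<in> sets M" and f: "integrable M f" and fC: "\<And>x. x \<in> B \<Longrightarrow> f x \<in> C"
  shows "\<exists>c\<in>C. (LINT x:B|M. f x - c) = 0"
proof -
  interpret finite_measure M by fact
  have f_B: "set_integrable M B f"
    using integrable_mult_indicator[OF B f] by (simp add: set_integrable_def)
  show ?thesis
  proof (cases "measure M B = 0")
    case True
    then have "AE x in M. x \<notin> B"
      by (intro AE_not_in) (simp add: null_sets_def emeasure_eq_measure)
    then have "(LINT x:B|M. f x - c) = 0" for c
      unfolding set_lebesgue_integral_def by (intro integral_eq_zero_AE) auto
    then show ?thesis
      using C by blast
  next
    case False
    then have "0 < measure M B"
      by (simp add: zero_less_measure_iff)
    define c where "c = (1 / measure M B) *\<^sub>R (LINT x:B|M. f x)"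
    have "c \<in> C"
      unfolding c_def using C(1,2) B \<open>0 < measure M B\<close> f_B fC by (rule centroid_in_closed_convex)
    moreover have "set_integrable M B (\<lambda>x. c)"
      unfolding set_integrable_def by (intro integrable_mult_indicator) auto
    then have "(LINT x:B|M. f x - c) = (LINT x:B|M. f x) - measure M B *\<^sub>R c"
      using f_B by (simp add: set_integral_diff set_integral_const)
    then have "(LINT x:B|M. f x - c) = 0"
      using \<open>0 < measure M B\<close> by (simp add: c_def)
    ultimately show ?thesis
      by blast
  qed
qed

text \<open>
  The variational property of conditional expectation given a finite-valued \<open>Y\<close>: a function that
  integrates to zero over every fibre of \<open>Y\<close> is orthogonal to all functions of \<open>Y\<close>, so adding
  such a function can only increase its second moment.
\<close>

lemma integral_square_le_of_orthogonal:
  fixes W :: "'a \<Rightarrow> real" and Y :: "'a \<Rightarrow> 'b" and c :: "'b \<Rightarrow> real"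
  assumes "finite_measure M" and I: "finite I"
    and Y: "Y \<in> measurable M (count_space I)"
    and W [measurable]: "W \<in> borel_measurable M"
    and W2: "integrable M (\<lambda>x. (W x)\<^sup>2)"
    and orth: "\<And>i. i \<in> I \<Longrightarrow> (LINT x:{x \<in> space M. Y x = i}|M. W x) = 0"
  shows "(\<integral>\<^sup>+x. ennreal ((W x)\<^sup>2) \<partial>M) \<le> (\<integral>\<^sup>+x. ennreal ((W x + c (Y x))\<^sup>2) \<partial>M)"
proof -
  interpret finite_measure M by fact
  have cY [measurable]: "(\<lambda>x. c (Y x)) \<in> borel_measurable M"
    using measurable_compose[OF Y, of c borel] by simp
  have Yi [measurable]: "{x \<in> space M. Y x = i} \<in> sets M" if "i \<in> I" for i
    using measurable_sets[OF Y, of "{i}"] that by (simp add: vimage_def Int_def conj_commute)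
  have YI: "Y x \<in> I" if "x \<in> space M" for x
    using measurable_space[OF Y that] by simp
  have int_W: "integrable M W"
    using W2 W by (rule square_integrable_imp_integrable[rotated])
  have split: "c (Y x) * W x = (\<Sum>i\<in>I. c i * (indicator {x \<in> space M. Y x = i} x *\<^sub>R W x))"
    if "x \<in> space M" for x
  proof -
    have "(\<Sum>i\<in>I. c i * (indicator {x \<in> space M. Y x = i} x *\<^sub>R W x))
        = (\<Sum>i\<in>I. if i = Y x then c i * W x else 0)"
      using that by (intro sum.cong) (auto simp: indicator_def)
    then show ?thesis
      using I YI[OF that] by simp
  qed
  have int_Wi: "integrable M (\<lambda>x. indicator {x \<in> space M. Y x = i} x *\<^sub>R W x)" if "i \<in> I" for i
    using integrable_mult_indicator[OF Yi[OF that] int_W] .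
  have int_cW: "integrable M (\<lambda>x. c (Y x) * W x)"
    by (subst Bochner_Integration.integrable_cong[OF refl split], assumption,
        intro Bochner_Integration.integrable_sum integrable_mult_right int_Wi)
  have zero: "(\<integral>x. c (Y x) * W x \<partial>M) = 0"
  proof -
    have "(\<integral>x. c (Y x) * W x \<partial>M)
        = (\<Sum>i\<in>I. c i * (\<integral>x. indicator {x \<in> space M. Y x = i} x *\<^sub>R W x \<partial>M))"
      by (subst Bochner_Integration.integral_cong[OF refl split], assumption,
          subst Bochner_Integration.integral_sum)
        (use int_Wi in auto)
    then show ?thesis
      using orth by (simp add: set_lebesgue_integral_def)
  qed
  have int_c2: "integrable M (\<lambda>x. (c (Y x))\<^sup>2)"
  proof (rule integrable_const_bound[of _ "\<Sum>i\<in>I. (c i)\<^sup>2"])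
    show "AE x in M. norm ((c (Y x))\<^sup>2) \<le> (\<Sum>i\<in>I. (c i)\<^sup>2)"
      using YI I by (intro AE_I2) (auto intro!: member_le_sum)
  qed simp
  have expand: "(W x + c (Y x))\<^sup>2 = (W x)\<^sup>2 + 2 * (c (Y x) * W x) + (c (Y x))\<^sup>2" for x
    by (simp add: power2_eq_square algebra_simps)
  have int: "integrable M (\<lambda>x. (W x + c (Y x))\<^sup>2)"
    unfolding expand using W2 int_cW int_c2 by simp
  have "(\<integral>x. (W x)\<^sup>2 \<partial>M) \<le> (\<integral>x. (W x + c (Y x))\<^sup>2 \<partial>M)"
    unfolding expand using W2 int_cW int_c2 zero by simp
  then show ?thesis
    using W2 int by (simp add: nn_integral_eq_integral ennreal_leI)
qed

section \<open>Square roots of costs and Borel sets of a subspace\<close>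

lemma ennsqrt_mono: "a \<le> b \<Longrightarrow> ennsqrt a \<le> ennsqrt b"
  by (auto simp: ennsqrt_def top_unique intro!: ennreal_leI enn2real_mono simp: less_top)

lemma ennsqrt_cmult:
  assumes "0 < c"
  shows "ennsqrt (ennreal (c\<^sup>2) * a) = ennreal c * ennsqrt a"
  using assms
  by (cases a) (auto simp: ennsqrt_def ennreal_mult_top ennreal_mult_eq_top_iff enn2real_mult real_sqrt_mult
      simp flip: ennreal_mult)

text \<open>
  Measurability of the inclusion allows Borel functions of the ambient space to be integrated
  against laws that live on the subspace.
\<close>

lemma borel_of_subspace:
  fixes X :: "'a::topological_space set"
  shows space_borel_of_subspace: "space (borel_of (top_of_set X)) = X"
    and ident_measurable_borel_of: "(\<lambda>x. x) \<in> measurable (borel_of (top_of_set X)) borel"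
proof -
  let ?G = "{U. openin (top_of_set X) U}"
  have G: "?G \<subseteq> Pow X"
    by (auto dest: openin_imp_subset)
  then show "space (borel_of (top_of_set X)) = X"
    by (simp add: borel_of_def)
  show "(\<lambda>x. x) \<in> measurable (borel_of (top_of_set X)) borel"
  proof (rule borel_measurableI)
    fix S :: "'a set" assume "open S"
    then have "X \<inter> S \<in> ?G"
      by (simp add: openin_open_Int)
    then have "X \<inter> S \<in> sets (borel_of (top_of_set X))"
      using G by (simp add: borel_of_def sets_measure_of)
    then show "(\<lambda>x. x) -` S \<inter> space (borel_of (top_of_set X)) \<in> sets (borel_of (top_of_set X))"
      using G by (simp add: borel_of_def Int_commute)
  qed
qed

section \<open>Second moments and the covariance matrix\<close>

text \<open>
  Lower powers are dominated by \<open>1 + |f|\<^sup>4\<close>.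
\<close>

lemma integrable_norm_power:
  fixes f :: "'a \<Rightarrow> 'b::{banach, second_countable_topology}"
  assumes "finite_measure M" and [measurable]: "f \<in> borel_measurable M"
    and f4: "integrable M (\<lambda>x. norm (f x) ^ 4)" and k: "k \<le> 4"
  shows "integrable M (\<lambda>x. norm (f x) ^ k)"
proof -
  interpret finite_measure M by fact
  have "t ^ k \<le> 1 + t ^ 4" if "0 \<le> t" for t :: real
  proof (cases "t \<le> 1")
    case True
    then have "t ^ k \<le> 1"
      using that by (simp add: power_le_one)
    then show ?thesis
      using that by (smt (verit) zero_le_power)
  next
    case False
    then have "t ^ k \<le> t ^ 4"
      using k by (intro power_increasing) auto
    then show ?thesis by simp
  qed
  then have bound: "AE x in M. norm (norm (f x) ^ k) \<le> norm (1 + norm (f x) ^ 4)"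
    by (intro AE_I2) simp
  have "integrable M (\<lambda>x. 1 + norm (f x) ^ 4)"
    using f4 by simp
  moreover have "(\<lambda>x. norm (f x) ^ k) \<in> borel_measurable M"
    by measurable
  ultimately show ?thesis
    using bound by (rule Bochner_Integration.integrable_bound)
qed

locale square_integrable_law = prob_space \<xi> for \<xi> :: "(real ^ 'd) measure" +
  assumes ident [measurable]: "(\<lambda>x. x) \<in> borel_measurable \<xi>"
    and int_square: "integrable \<xi> (\<lambda>x. (norm x)\<^sup>2)"
begin

lemma int_ident: "integrable \<xi> (\<lambda>x. x)"
proof -
  have "integrable \<xi> (\<lambda>x. norm x)"
    by (rule square_integrable_imp_integrable) (use int_square in auto)
  then show ?thesis
    by (simp add: integrable_norm_iff)
qed

lemma int_coordinates: "integrable \<xi> (\<lambda>x. (x - a) $ i * (x - a) $ j)"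
proof (rule Bochner_Integration.integrable_bound)
  show "integrable \<xi> (\<lambda>x. 2 * (norm x)\<^sup>2 + 2 * (norm a)\<^sup>2)"
    using int_square by simp
  have "norm ((x - a) $ i * (x - a) $ j) \<le> norm (2 * (norm x)\<^sup>2 + 2 * (norm a)\<^sup>2)" for x
  proof -
    have "norm ((x - a) $ i * (x - a) $ j) \<le> norm (x - a) * norm (x - a)"
      unfolding norm_mult
      by (intro mult_mono) (simp_all add: component_le_norm_cart del: vector_minus_component)
    also have "\<dots> \<le> (norm x + norm a) * (norm x + norm a)"
      by (intro mult_mono norm_triangle_ineq4) auto
    also have "\<dots> \<le> 2 * (norm x)\<^sup>2 + 2 * (norm a)\<^sup>2"
      using sum_squares_bound[of "norm x" "norm a"] by (simp add: power2_eq_square algebra_simps)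
    finally show ?thesis
      by simp
  qed
  then show "AE x in \<xi>. norm ((x - a) $ i * (x - a) $ j) \<le> norm (2 * (norm x)\<^sup>2 + 2 * (norm a)\<^sup>2)"
    by simp
  have "(\<lambda>x. (x - a) $ i) \<in> borel_measurable \<xi>" for i
    by (intro borel_measurable_continuous_on[OF _ ident] continuous_intros)
  then show "(\<lambda>x. (x - a) $ i * (x - a) $ j) \<in> borel_measurable \<xi>"
    by (intro borel_measurable_times)
qed

lemma inner_square_expand:
  "(u \<bullet> w)\<^sup>2 = (\<Sum>i\<in>UNIV. \<Sum>j\<in>UNIV. u $ i * (u $ j * (w $ i * w $ j)))" for u w :: "real ^ 'd"
  by (simp add: inner_vec_def power2_eq_square sum_product mult_ac)

lemma int_inner_square: "integrable \<xi> (\<lambda>x. (u \<bullet> (x - a))\<^sup>2)"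
  unfolding inner_square_expand
  by (intro Bochner_Integration.integrable_sum integrable_mult_right int_coordinates)

lemma variance_inner_eq_cov_matrix:
  "(\<integral>x. (u \<bullet> (x - mean_vec \<xi>))\<^sup>2 \<partial>\<xi>) = u \<bullet> (cov_matrix \<xi> *v u)"
proof -
  have "(\<integral>x. (u \<bullet> (x - mean_vec \<xi>))\<^sup>2 \<partial>\<xi>)
      = (\<Sum>i\<in>UNIV. \<Sum>j\<in>UNIV. u $ i * (u $ j *
          (\<integral>x. (x - mean_vec \<xi>) $ i * (x - mean_vec \<xi>) $ j \<partial>\<xi>)))"
    unfolding inner_square_expand
    using int_coordinates[of "mean_vec \<xi>"]
    by (simp add: Bochner_Integration.integral_sum del: vector_minus_component)
  then show ?thesis
    by (simp add: inner_vec_def matrix_vector_mult_def cov_matrix_def sum_distrib_left mult_ac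
        del: vector_minus_component)
qed

lemma transpose_cov_matrix: "transpose (cov_matrix \<xi>) = cov_matrix \<xi>"
  by (simp add: transpose_def cov_matrix_def vec_eq_iff mult.commute)

text \<open>
  The place where the covariance matrix enters. A second moment is at least a variance, and the
  variance of \<open>x \<mapsto> 2 (u \<bullet> x)\<close> is four times the quadratic form of the covariance matrix at \<open>u\<close>.
  The constant \<open>a\<close> only adds to the mean, so the bound is uniform in \<open>a\<close>.
\<close>

lemma affine_second_moment_lower_bound:
  "ennreal (4 * lambda_min (cov_matrix \<xi>) * (norm u)\<^sup>2)
     \<le> (\<integral>\<^sup>+x. ennreal ((a - 2 * (u \<bullet> x))\<^sup>2) \<partial>\<xi>)"
proof -
  define b where "b = a - 2 * (u \<bullet> mean_vec \<xi>)"
  have expand: "(a - 2 * (u \<bullet> x))\<^sup>2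
      = b\<^sup>2 - 4 * b * (u \<bullet> (x - mean_vec \<xi>)) + 4 * (u \<bullet> (x - mean_vec \<xi>))\<^sup>2" for x
    by (simp add: b_def inner_diff_right power2_eq_square algebra_simps)
  have int_lin: "integrable \<xi> (\<lambda>x. u \<bullet> (x - mean_vec \<xi>))"
    using int_ident by simp
  have "(\<integral>x. u \<bullet> (x - mean_vec \<xi>) \<partial>\<xi>) = 0"
    using int_ident by (simp add: mean_vec_def prob_space inner_diff_right)
  then have "(\<integral>x. (a - 2 * (u \<bullet> x))\<^sup>2 \<partial>\<xi>) = b\<^sup>2 + 4 * (u \<bullet> (cov_matrix \<xi> *v u))"
    unfolding expand using int_lin int_inner_square[of u "mean_vec \<xi>"]
    by (simp add: prob_space variance_inner_eq_cov_matrix)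
  moreover have "lambda_min (cov_matrix \<xi>) * (norm u)\<^sup>2 \<le> u \<bullet> (cov_matrix \<xi> *v u)"
    by (rule least_rayleigh_value[OF transpose_cov_matrix])
  ultimately have "4 * lambda_min (cov_matrix \<xi>) * (norm u)\<^sup>2 \<le> (\<integral>x. (a - 2 * (u \<bullet> x))\<^sup>2 \<partial>\<xi>)"
    using zero_le_power2[of b] unfolding mult.assoc by linarith
  moreover have "integrable \<xi> (\<lambda>x. (a - 2 * (u \<bullet> x))\<^sup>2)"
    unfolding expand using int_lin int_inner_square[of u "mean_vec \<xi>"] by simp
  ultimately show ?thesis
    by (simp add: nn_integral_eq_integral ennreal_leI)
qed

end

section \<open>Couplings with finitely many labels\<close>

text \<open>
  A coupling of the given law with a law on \<open>n\<close> labels. It is the same thing as a random point of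
  \<open>X\<close> with a random label attached; the fibres of the label cut the mass into at most \<open>n\<close> cells.
\<close>

locale finite_coupling =
  fixes X :: "(real ^ 'd) set" and \<xi> :: "(real ^ 'd) measure"
    and n :: nat and \<upsilon> :: "nat measure" and \<pi> :: "((real ^ 'd) \<times> nat) measure"
  assumes closed: "closed X" and convex: "convex X"
    and prob_source: "prob_space \<xi>" and sets_source: "sets \<xi> = sets (borel_of (top_of_set X))"
    and sets_target: "sets \<upsilon> = Pow {1..n}"
    and coupling: "\<pi> \<in> couplings \<xi> \<upsilon>"
    and fourth_moment: "integrable \<xi> (\<lambda>x. norm x ^ 4)"
begin

lemma sets_coupling: "sets \<pi> = sets (\<xi> \<Otimes>\<^sub>M \<upsilon>)"
  and distr_fst: "distr \<pi> \<xi> fst = \<xi>"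
  and distr_snd: "distr \<pi> \<upsilon> snd = \<upsilon>"
  using coupling by (auto simp: couplings_def)

lemma space_source: "space \<xi> = X"
  using sets_eq_imp_space_eq[OF sets_source] by (simp add: space_borel_of_subspace)

lemma space_target: "space \<upsilon> = {1..n}"
  using sets_target by (metis sets.sets_into_space sets.top Pow_top PowD subset_antisym)

lemma space_coupling: "space \<pi> = X \<times> {1..n}"
  using sets_eq_imp_space_eq[OF sets_coupling] by (simp add: space_pair_measure space_source space_target)

lemma fst_measurable [measurable]: "fst \<in> measurable \<pi> \<xi>"
  and snd_measurable [measurable]: "snd \<in> measurable \<pi> \<upsilon>"
  by (simp_all cong: measurable_cong_sets add: measurable_cong_sets[OF sets_coupling refl])

lemma measurable_from_target: "(\<And>i. i \<in> {1..n} \<Longrightarrow> f i \<in> space N) \<Longrightarrow> f \<in> measurable \<upsilon> N"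
  by (auto simp: measurable_def sets_target space_target)

lemma label_measurable: "(\<lambda>z. f (snd z)) \<in> borel_measurable \<pi>"
  for f :: "nat \<Rightarrow> 'b::topological_space"
  by (rule measurable_compose[OF snd_measurable measurable_from_target]) simp

lemma prob_coupling: "prob_space \<pi>"
  using prob_source distr_fst fst_measurable by (metis prob_space_distrD)

sublocale prob_space \<pi>
  by (rule prob_coupling)

lemma source_ident: "(\<lambda>x. x) \<in> borel_measurable \<xi>"
  using ident_measurable_borel_of[of X] by (simp cong: measurable_cong_sets add: measurable_cong_sets[OF sets_source refl])

lemma point_measurable [measurable]: "fst \<in> borel_measurable \<pi>"
  using measurable_compose[OF fst_measurable source_ident] by simp

sublocale source: square_integrable_law \<xi>
proof -
  interpret law: prob_space \<xi> by (rule prob_source)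
  show "square_integrable_law \<xi>"
    by unfold_locales
      (use source_ident integrable_norm_power[OF law.finite_measure_axioms source_ident fourth_moment, of 2]
        in auto)
qed

lemma integrable_point: "integrable \<xi> f \<Longrightarrow> integrable \<pi> (\<lambda>z. f (fst z))"
  for f :: "real ^ 'd \<Rightarrow> 'b::{banach, second_countable_topology}"
  using integrable_distr[OF fst_measurable, of f] by (simp add: distr_fst)

lemma nn_integral_point:
  "f \<in> borel_measurable \<xi> \<Longrightarrow> (\<integral>\<^sup>+z. f (fst z) \<partial>\<pi>) = (\<integral>\<^sup>+x. f x \<partial>\<xi>)"
  using nn_integral_distr[OF fst_measurable, of f] by (simp add: distr_fst)

definition cell :: "nat \<Rightarrow> ((real ^ 'd) \<times> nat) set" where
  "cell i = {z \<in> space \<pi>. snd z = i}"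

lemma cell_sets: "i \<in> {1..n} \<Longrightarrow> cell i \<in> sets \<pi>"
  using measurable_sets[OF snd_measurable, of "{i}"]
  by (simp add: cell_def sets_target vimage_def Int_def conj_commute)

section \<open>Quantization by the cell centroids\<close>

text \<open>
  Any choice of points \<open>m i\<close> in \<open>X\<close> turns labels into points of \<open>X\<close>. The image of the label law is
  a competitor for \<open>qW\<close>, and the image of the coupling transports the given law onto it.
\<close>

lemma qW_le_of_codebook:
  assumes m: "\<And>i. i \<in> {1..n} \<Longrightarrow> m i \<in> X"
  shows "qW n X \<xi> \<le> ennsqrt (\<integral>\<^sup>+z. ennreal ((norm (fst z - m (snd z)))\<^sup>2) \<partial>\<pi>)"
proof -
  let ?B = "borel_of (top_of_set X)"
  have m_meas: "m \<in> measurable \<upsilon> ?B"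
    using m by (intro measurable_from_target) (simp add: space_borel_of_subspace)
  have m_snd [measurable]: "(\<lambda>z. m (snd z)) \<in> measurable \<pi> ?B"
    by (rule measurable_compose[OF snd_measurable m_meas])
  define \<nu> where "\<nu> = distr \<upsilon> ?B m"
  define \<rho> where "\<rho> = distr \<pi> (\<xi> \<Otimes>\<^sub>M \<nu>) (\<lambda>z. (fst z, m (snd z)))"
  have sets_\<nu> [measurable_cong]: "sets \<nu> = sets ?B"
    by (simp add: \<nu>_def)
  have prob_target: "prob_space \<upsilon>"
    using prob_space_distr[OF snd_measurable] by (simp add: distr_snd)
  interpret target: prob_space \<upsilon> by (rule prob_target)
  have "\<nu> \<in> Pn n X"
  proof -
    define w where "w i = measure \<upsilon> {i}" for i
    have "(\<Sum>i=1..n. w i) = measure \<upsilon> (\<Union>i\<in>{1..n}. {i})"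
      unfolding w_def by (subst target.finite_measure_finite_Union)
        (auto simp: sets_target disjoint_family_on_def)
    then have "(\<Sum>i=1..n. w i) = 1"
      using target.prob_space by (simp add: space_target)
    moreover have "emeasure \<nu> A = (\<Sum>i=1..n. ennreal (w i) * emeasure (return ?B (m i)) A)"
      if A: "A \<in> sets \<nu>" for A
    proof -
      have "emeasure \<nu> A = emeasure \<upsilon> {i\<in>{1..n}. m i \<in> A}"
        using A unfolding \<nu>_def
        by (subst emeasure_distr[OF m_meas])
          (auto simp: space_target intro!: arg_cong[of _ _ "emeasure \<upsilon>"])
      also have "\<dots> = (\<Sum>i\<in>{i\<in>{1..n}. m i \<in> A}. emeasure \<upsilon> {i})"
        by (intro emeasure_eq_sum_singleton) (auto simp: sets_target)
      also have "\<dots> = (\<Sum>i=1..n. ennreal (w i) * emeasure (return ?B (m i)) A)"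
        using A by (intro sum.mono_neutral_cong_left)
          (auto simp: sets_\<nu> w_def target.emeasure_eq_measure)
      finally show ?thesis .
    qed
    ultimately show ?thesis
      unfolding Pn_def using m sets_\<nu> by (auto intro!: exI[of _ m] exI[of _ w] simp: w_def)
  qed
  have pair [measurable]: "(\<lambda>z. (fst z, m (snd z))) \<in> measurable \<pi> (\<xi> \<Otimes>\<^sub>M \<nu>)"
    using m_snd by (intro measurable_Pair) (simp_all add: measurable_cong_sets[OF refl sets_\<nu>])
  have "\<rho> \<in> couplings \<xi> \<nu>"
  proof -
    have "distr \<rho> \<xi> fst = \<xi>"
      unfolding \<rho>_def by (simp add: distr_distr comp_def distr_fst)
    moreover have "distr \<rho> \<nu> snd = distr \<pi> ?B (\<lambda>z. m (snd z))"
      unfolding \<rho>_def by (simp add: distr_distr comp_def cong: distr_cong) (auto intro!: distr_cong simp: sets_\<nu>)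
    moreover have "\<dots> = \<nu>"
      using distr_distr[OF m_meas snd_measurable] by (simp add: \<nu>_def distr_snd comp_def)
    ultimately show ?thesis
      by (simp add: couplings_def \<rho>_def)
  qed
  moreover have "(\<integral>\<^sup>+(x, y). ennreal ((norm (x - y))\<^sup>2) \<partial>\<rho>)
      = (\<integral>\<^sup>+z. ennreal ((norm (fst z - m (snd z)))\<^sup>2) \<partial>\<pi>)"
  proof -
    have [measurable]: "(\<lambda>x. x) \<in> borel_measurable \<nu>"
      using ident_measurable_borel_of[of X] by (simp cong: measurable_cong_sets add: measurable_cong_sets[OF sets_\<nu> refl])
    have [measurable]: "fst \<in> borel_measurable (\<xi> \<Otimes>\<^sub>M \<nu>)" "snd \<in> borel_measurable (\<xi> \<Otimes>\<^sub>M \<nu>)"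
      using measurable_compose[OF measurable_fst source_ident, of \<nu>]
        measurable_compose[OF measurable_snd[of \<xi> \<nu>] \<open>(\<lambda>x. x) \<in> borel_measurable \<nu>\<close>] by simp_all
    show ?thesis
      unfolding \<rho>_def case_prod_beta by (subst nn_integral_distr[OF pair]) simp_all
  qed
  ultimately have "W2 \<xi> \<nu> \<le> ennsqrt (\<integral>\<^sup>+z. ennreal ((norm (fst z - m (snd z)))\<^sup>2) \<partial>\<pi>)"
    unfolding W2_def by (intro INF_lower2[of \<rho>]) auto
  then show ?thesis
    unfolding qW_def by (intro INF_lower2[OF \<open>\<nu> \<in> Pn n X\<close>])
qed

lemma label_count_measurable: "snd \<in> measurable \<pi> (count_space {1..n})"
  by (rule measurable_compose[OF snd_measurable measurable_from_target, of "\<lambda>i. i"]) simp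

lemma exists_cell_centre:
  fixes f :: "real ^ 'd \<Rightarrow> 'b::euclidean_space"
  assumes "closed C" "convex C" "C \<noteq> {}" "integrable \<xi> f" "\<And>x. x \<in> X \<Longrightarrow> f x \<in> C"
  shows "\<exists>c. \<forall>i\<in>{1..n}. c i \<in> C \<and> (LINT z:cell i|\<pi>. f (fst z) - c i) = 0"
proof -
  have "\<exists>c\<in>C. (LINT z:cell i|\<pi>. f (fst z) - c) = 0" if "i \<in> {1..n}" for i
  proof (rule exists_centring_point[OF finite_measure_axioms assms(1-3) cell_sets[OF that]])
    show "integrable \<pi> (\<lambda>z. f (fst z))"
      by (rule integrable_point) fact
    show "f (fst z) \<in> C" if "z \<in> cell i" for z
      using that assms(5) by (auto simp: cell_def space_coupling)
  qed
  then show ?thesis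
    by (intro bchoice) blast
qed

text \<open>
  A function of the label takes finitely many values, so subtracting it preserves square
  integrability.
\<close>

lemma integrable_sub_label:
  fixes f :: "(real ^ 'd) \<times> nat \<Rightarrow> real"
  assumes [measurable]: "f \<in> borel_measurable \<pi>" and f2: "integrable \<pi> (\<lambda>z. (f z)\<^sup>2)"
  shows "integrable \<pi> (\<lambda>z. (f z - c (snd z))\<^sup>2)"
proof (rule Bochner_Integration.integrable_bound)
  let ?K = "\<Sum>i\<in>{1..n}. (c i)\<^sup>2"
  show "integrable \<pi> (\<lambda>z. 2 * (f z)\<^sup>2 + 2 * ?K)"
    using f2 by simp
  show "AE z in \<pi>. norm ((f z - c (snd z))\<^sup>2) \<le> norm (2 * (f z)\<^sup>2 + 2 * ?K)"
  proof (rule AE_I2)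
    fix z assume "z \<in> space \<pi>"
    then have "(c (snd z))\<^sup>2 \<le> ?K"
      by (intro member_le_sum) (auto simp: space_coupling)
    moreover have "(f z - c (snd z))\<^sup>2 \<le> 2 * (f z)\<^sup>2 + 2 * (c (snd z))\<^sup>2"
      using zero_le_power2[of "f z + c (snd z)"] by (simp add: power2_eq_square algebra_simps)
    ultimately show "norm ((f z - c (snd z))\<^sup>2) \<le> norm (2 * (f z)\<^sup>2 + 2 * ?K)"
      by simp
  qed
  show "(\<lambda>z. (f z - c (snd z))\<^sup>2) \<in> borel_measurable \<pi>"
    using label_measurable[of c] by measurable
qed

section \<open>Lower bounds for the distortion cost\<close>

text \<open>
  With \<open>z = (x, y)\<close> fixed, \<open>|x - x'|\<^sup>2\<close> is \<open>V z' - 2 (U z' \<bullet> x)\<close> plus a function of the label \<open>y'\<close>,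
  where \<open>U\<close> and \<open>V\<close> are the deviations of the point and of its squared norm from their means over
  the cell. As \<open>G y y'\<close> is also a function of \<open>y'\<close>, orthogonality discards both, and the
  bound becomes uniform in the matrix. Exchanging the integrals, the integral over \<open>x\<close> with \<open>z'\<close> fixed is
  at least \<open>4 \<lambda>\<^sub>m\<^sub>i\<^sub>n |U z'|\<^sup>2\<close>, and the integral of \<open>|U z'|\<^sup>2\<close> is the transport cost to the cell
  centroids.
\<close>

lemma squared_distance_cost_lower_bound:
  "ennreal (2 * sqrt (lambda_min (cov_matrix \<xi>))) * qW n X \<xi>
     \<le> ennsqrt (\<integral>\<^sup>+(x, y). (\<integral>\<^sup>+(x', y'). ennreal (((norm (x - x'))\<^sup>2 - G y y')\<^sup>2) \<partial>\<pi>) \<partial>\<pi>)"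
    (is "_ \<le> ennsqrt ?cost")
proof (cases "0 < lambda_min (cov_matrix \<xi>)")
  case False
  then show ?thesis
    by (simp add: ennreal_neg)
next
  case True
  define \<kappa> where "\<kappa> = lambda_min (cov_matrix \<xi>)"
  have "X \<noteq> {}"
    using not_empty by (auto simp: space_coupling)
  then obtain m where m: "\<And>i. i \<in> {1..n} \<Longrightarrow> m i \<in> X"
    and m_centres: "\<And>i. i \<in> {1..n} \<Longrightarrow> (LINT z:cell i|\<pi>. fst z - m i) = 0"
    using exists_cell_centre[OF closed convex _ source.int_ident] by blast
  obtain v :: "nat \<Rightarrow> real"
    where v_centres: "\<And>i. i \<in> {1..n} \<Longrightarrow> (LINT z:cell i|\<pi>. (norm (fst z))\<^sup>2 - v i) = 0"
    using exists_cell_centre[of UNIV "\<lambda>x. (norm x)\<^sup>2", OF closed_UNIV convex_UNIV _ source.int_square]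
    by blast
  define U where "U z = fst z - m (snd z)" for z
  define V where "V z = (norm (fst z))\<^sup>2 - v (snd z)" for z :: "(real ^ 'd) \<times> nat"
  have [measurable]: "U \<in> borel_measurable \<pi>" "V \<in> borel_measurable \<pi>"
    unfolding U_def V_def using label_measurable[of m] label_measurable[of v] by measurable
  have inner_bound: "(\<integral>\<^sup>+z'. ennreal ((V z' - 2 * (U z' \<bullet> fst z))\<^sup>2) \<partial>\<pi>)
      \<le> (\<integral>\<^sup>+z'. ennreal (((norm (fst z - fst z'))\<^sup>2 - G (snd z) (snd z'))\<^sup>2) \<partial>\<pi>)" for z
  proof -
    let ?x = "fst z"
    define W where "W z' = V z' - 2 * (U z' \<bullet> ?x)" for z'
    define c where "c i = v i - 2 * (m i \<bullet> ?x) + (norm ?x)\<^sup>2 - G (snd z) i" for i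
    have [measurable]: "W \<in> borel_measurable \<pi>"
      unfolding W_def by measurable
    \<comment> \<open>\<open>W\<close> differs from this function by a function of the label only.\<close>
    have raw: "integrable \<pi> (\<lambda>z'. ((norm (fst z'))\<^sup>2 - 2 * (fst z' \<bullet> ?x))\<^sup>2)"
    proof (rule Bochner_Integration.integrable_bound)
      show "integrable \<pi> (\<lambda>z'. 2 * norm (fst z') ^ 4 + 8 * (norm ?x)\<^sup>2 * (norm (fst z'))\<^sup>2)"
        using integrable_point[OF fourth_moment] integrable_point[OF source.int_square] by simp
      have "((norm y)\<^sup>2 - 2 * (y \<bullet> ?x))\<^sup>2 \<le> 2 * norm y ^ 4 + 8 * (norm ?x)\<^sup>2 * (norm y)\<^sup>2" for y
      proof -
        have "((norm y)\<^sup>2 - 2 * (y \<bullet> ?x))\<^sup>2 \<le> 2 * ((norm y)\<^sup>2)\<^sup>2 + 8 * (y \<bullet> ?x)\<^sup>2"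
          using zero_le_power2[of "(norm y)\<^sup>2 + 2 * (y \<bullet> ?x)"]
          by (simp add: power2_sum power2_diff power_mult_distrib)
        moreover have "(y \<bullet> ?x)\<^sup>2 \<le> (norm y)\<^sup>2 * (norm ?x)\<^sup>2"
          using Cauchy_Schwarz_ineq[of y ?x] by (simp add: power2_norm_eq_inner)
        ultimately show ?thesis
          by (simp add: mult_ac flip: power_mult)
      qed
      then show "AE z' in \<pi>. norm (((norm (fst z'))\<^sup>2 - 2 * (fst z' \<bullet> ?x))\<^sup>2)
          \<le> norm (2 * norm (fst z') ^ 4 + 8 * (norm ?x)\<^sup>2 * (norm (fst z'))\<^sup>2)"
        by simp
    qed measurable
    have W2: "integrable \<pi> (\<lambda>z'. (W z')\<^sup>2)"
    proof -
      have "W = (\<lambda>z'. ((norm (fst z'))\<^sup>2 - 2 * (fst z' \<bullet> ?x)) - (v (snd z') - 2 * (m (snd z') \<bullet> ?x)))"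
        by (simp add: W_def V_def U_def fun_eq_iff inner_diff_left)
      then show ?thesis
        using integrable_sub_label[OF _ raw, of "\<lambda>i. v i - 2 * (m i \<bullet> ?x)"] by simp
    qed
    have orth: "(LINT z':{z' \<in> space \<pi>. snd z' = i}|\<pi>. W z') = 0" if i: "i \<in> {1..n}" for i
    proof -
      define p where "p z' = indicator (cell i) z' *\<^sub>R ((norm (fst z'))\<^sup>2 - v i)" for z'
      define q where "q z' = indicator (cell i) z' *\<^sub>R (fst z' - m i)" for z'
      have pq: "integrable \<pi> p" "integrable \<pi> q"
        unfolding p_def q_def
        using cell_sets[OF i] integrable_point[OF source.int_square] integrable_point[OF source.int_ident]
        by (intro integrable_mult_indicator; simp)+
      have "(LINT z':cell i|\<pi>. W z') = (\<integral>z'. p z' - 2 * (q z' \<bullet> ?x) \<partial>\<pi>)"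
        unfolding set_lebesgue_integral_def
        by (intro Bochner_Integration.integral_cong)
          (auto simp: p_def q_def cell_def W_def V_def U_def indicator_def)
      also have "\<dots> = (\<integral>z'. p z' \<partial>\<pi>) - 2 * ((\<integral>z'. q z' \<partial>\<pi>) \<bullet> ?x)"
        using pq by simp
      finally show ?thesis
        using m_centres[OF i] v_centres[OF i]
        by (simp add: cell_def p_def q_def set_lebesgue_integral_def)
    qed
    have "(\<integral>\<^sup>+z'. ennreal ((W z')\<^sup>2) \<partial>\<pi>) \<le> (\<integral>\<^sup>+z'. ennreal ((W z' + c (snd z'))\<^sup>2) \<partial>\<pi>)"
      by (rule integral_square_le_of_orthogonal[OF finite_measure_axioms _ label_count_measurable _ W2 orth])
        simp_all
    moreover have "W z' + c (snd z') = (norm (?x - fst z'))\<^sup>2 - G (snd z) (snd z')" for z'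
      by (simp add: W_def V_def U_def c_def inner_diff_left inner_diff_right inner_commute
          power2_norm_eq_inner)
    ultimately show ?thesis
      by (simp add: W_def)
  qed
  interpret pair: pair_prob_space \<pi> \<pi> ..
  have "ennreal ((2 * sqrt \<kappa>)\<^sup>2) * (\<integral>\<^sup>+z'. ennreal ((norm (U z'))\<^sup>2) \<partial>\<pi>)
      = (\<integral>\<^sup>+z'. ennreal (4 * \<kappa> * (norm (U z'))\<^sup>2) \<partial>\<pi>)"
    using True by (subst nn_integral_cmult[symmetric]) (simp_all add: \<kappa>_def ennreal_mult power_mult_distrib)
  also have "\<dots> \<le> (\<integral>\<^sup>+z'. (\<integral>\<^sup>+z. ennreal ((V z' - 2 * (U z' \<bullet> fst z))\<^sup>2) \<partial>\<pi>) \<partial>\<pi>)"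
  proof (rule nn_integral_mono)
    fix z'
    have "(\<lambda>x. ennreal ((V z' - 2 * (U z' \<bullet> x))\<^sup>2)) \<in> borel_measurable \<xi>"
      by measurable
    then show "ennreal (4 * \<kappa> * (norm (U z'))\<^sup>2)
        \<le> (\<integral>\<^sup>+z. ennreal ((V z' - 2 * (U z' \<bullet> fst z))\<^sup>2) \<partial>\<pi>)"
      unfolding \<kappa>_def nn_integral_point[OF \<open>_ \<in> borel_measurable \<xi>\<close>]
      using source.affine_second_moment_lower_bound by simp
  qed
  also have "\<dots> = (\<integral>\<^sup>+z. (\<integral>\<^sup>+z'. ennreal ((V z' - 2 * (U z' \<bullet> fst z))\<^sup>2) \<partial>\<pi>) \<partial>\<pi>)"
  proof (rule pair.Fubini')
    show "(\<lambda>(z, z'). ennreal ((V z' - 2 * (U z' \<bullet> fst z))\<^sup>2)) \<in> borel_measurable (\<pi> \<Otimes>\<^sub>M \<pi>)"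
      by measurable
  qed
  also have "\<dots> \<le> ?cost"
    unfolding case_prod_beta by (intro nn_integral_mono inner_bound)
  finally have "ennsqrt (ennreal ((2 * sqrt \<kappa>)\<^sup>2) * (\<integral>\<^sup>+z'. ennreal ((norm (U z'))\<^sup>2) \<partial>\<pi>)) \<le> ennsqrt ?cost"
    by (rule ennsqrt_mono)
  moreover have "qW n X \<xi> \<le> ennsqrt (\<integral>\<^sup>+z'. ennreal ((norm (U z'))\<^sup>2) \<partial>\<pi>)"
    unfolding U_def by (rule qW_le_of_codebook[OF m])
  ultimately show ?thesis
    using True ennsqrt_cmult[of "2 * sqrt \<kappa>"]
    by (metis (no_types, lifting) \<kappa>_def mult_left_mono order_trans zero_le zero_less_mult_iff
        real_sqrt_gt_0_iff zero_less_numeral)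
qed

text \<open>
  The gauge is only determined almost everywhere, but the two marginals on points of the product
  of the coupling with itself have the given law, so the cost does not see the representative.
\<close>

lemma nn_integral_cong_pair_AE:
  assumes "AE (x, x') in \<xi> \<Otimes>\<^sub>M \<xi>. g x x' = g' x x'"
  shows "(\<integral>\<^sup>+(x, y). (\<integral>\<^sup>+(x', y'). F (g x x') y y' \<partial>\<pi>) \<partial>\<pi>)
    = (\<integral>\<^sup>+(x, y). (\<integral>\<^sup>+(x', y'). F (g' x x') y y' \<partial>\<pi>) \<partial>\<pi>)"
proof -
  interpret source_pair: pair_prob_space \<xi> \<xi> ..
  have "AE x in \<xi>. AE x' in \<xi>. g x x' = g' x x'"
    using source_pair.AE_pair[OF assms] by simp
  then have "AE z in \<pi>. AE x' in \<xi>. g (fst z) x' = g' (fst z) x'"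
    by (intro AE_distrD[OF fst_measurable]) (simp only: distr_fst)
  then have "AE z in \<pi>. AE z' in \<pi>. g (fst z) (fst z') = g' (fst z) (fst z')"
  proof eventually_elim
    fix z assume "AE x' in \<xi>. g (fst z) x' = g' (fst z) x'"
    then show "AE z' in \<pi>. g (fst z) (fst z') = g' (fst z) (fst z')"
      by (intro AE_distrD[OF fst_measurable]) (simp only: distr_fst)
  qed
  then show ?thesis
    unfolding case_prod_beta
    by (intro nn_integral_cong_AE, eventually_elim)
      (rule nn_integral_cong_AE, auto elim: eventually_mono)
qed

text \<open>
  Truncating \<open>c\<close> to \<open>[0, D]\<close> does not move it away from \<open>t\<close>, and squaring is Lipschitz with constant \<open>2 D\<close>
  on that interval.
\<close>

lemma clamp_square_error:
  fixes t c D :: real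
  assumes "0 \<le> t" "t \<le> D"
  shows "(t\<^sup>2 - (max 0 (min D c))\<^sup>2)\<^sup>2 \<le> (2 * D)\<^sup>2 * (t - c)\<^sup>2"
proof -
  define c' where "c' = max 0 (min D c)"
  have c': "0 \<le> c'" "c' \<le> D" "\<bar>t - c'\<bar> \<le> \<bar>t - c\<bar>"
    using assms by (auto simp: c'_def)
  have "\<bar>t\<^sup>2 - c'\<^sup>2\<bar> = (t + c') * \<bar>t - c'\<bar>"
    using assms c' by (simp add: power2_eq_square square_diff_square_factored abs_mult)
  also have "\<dots> \<le> (2 * D) * \<bar>t - c\<bar>"
    using assms c' by (intro mult_mono) auto
  finally have "\<bar>t\<^sup>2 - c'\<^sup>2\<bar>\<^sup>2 \<le> ((2 * D) * \<bar>t - c\<bar>)\<^sup>2"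
    by (rule power_mono) simp
  then show ?thesis
    by (simp add: c'_def power_mult_distrib)
qed

text \<open>
  By the previous estimate the squares of the truncated matrix entries approximate the squared
  distances at most \<open>2 D\<close> times worse than the matrix approximates the distances. Since the bound
  for squared distances holds for every matrix, it applies to these squares.
\<close>

lemma distance_cost_lower_bound:
  assumes D: "0 < D" "\<And>x x'. x \<in> X \<Longrightarrow> x' \<in> X \<Longrightarrow> norm (x - x') \<le> D"
  shows "ennreal (sqrt (lambda_min (cov_matrix \<xi>)) / D) * qW n X \<xi>
     \<le> ennsqrt (\<integral>\<^sup>+(x, y). (\<integral>\<^sup>+(x', y'). ennreal ((norm (x - x') - G y y')\<^sup>2) \<partial>\<pi>) \<partial>\<pi>)"
    (is "_ \<le> ennsqrt ?cost")
proof (cases "0 < lambda_min (cov_matrix \<xi>)")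
  case False
  then have "sqrt (lambda_min (cov_matrix \<xi>)) / D \<le> 0"
    using D(1) by (simp add: divide_nonpos_pos)
  then show ?thesis
    by (simp add: ennreal_neg)
next
  case True
  interpret pair: pair_prob_space \<pi> \<pi> ..
  define H where "H i j = (max 0 (min D (G i j)))\<^sup>2" for i j
  let ?sq_cost = "\<integral>\<^sup>+(x, y). (\<integral>\<^sup>+(x', y'). ennreal (((norm (x - x'))\<^sup>2 - H y y')\<^sup>2) \<partial>\<pi>) \<partial>\<pi>"
  let ?l = "ennreal (2 * sqrt (lambda_min (cov_matrix \<xi>)))"
  have labels: "(\<lambda>p. G (snd (fst p)) (snd (snd p))) \<in> borel_measurable (\<pi> \<Otimes>\<^sub>M \<pi>)"
  proof -
    have "(\<lambda>p. (snd (fst p), snd (snd p))) \<in>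
        measurable (\<pi> \<Otimes>\<^sub>M \<pi>) (count_space {1..n} \<Otimes>\<^sub>M count_space {1..n})"
      using label_count_measurable by measurable
    moreover have "(\<lambda>(i, j). G i j) \<in> borel_measurable (count_space {1..n} \<Otimes>\<^sub>M count_space {1..n})"
      by (simp add: pair_measure_countable countable_finite)
    ultimately show ?thesis
      using measurable_compose by fastforce
  qed
  have meas: "(\<lambda>(z, z'). ennreal ((norm (fst z - fst z') - G (snd z) (snd z'))\<^sup>2)) \<in> borel_measurable (\<pi> \<Otimes>\<^sub>M \<pi>)"
    using labels unfolding case_prod_beta by measurable
  have "?sq_cost \<le> (\<integral>\<^sup>+z. (\<integral>\<^sup>+z'. ennreal ((2 * D)\<^sup>2) *
      ennreal ((norm (fst z - fst z') - G (snd z) (snd z'))\<^sup>2) \<partial>\<pi>) \<partial>\<pi>)"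
    unfolding case_prod_beta
  proof (intro nn_integral_mono)
    fix z z' assume "z \<in> space \<pi>" "z' \<in> space \<pi>"
    then have "norm (fst z - fst z') \<le> D"
      using D(2) by (auto simp: space_coupling)
    then show "ennreal (((norm (fst z - fst z'))\<^sup>2 - H (snd z) (snd z'))\<^sup>2)
        \<le> ennreal ((2 * D)\<^sup>2) * ennreal ((norm (fst z - fst z') - G (snd z) (snd z'))\<^sup>2)"
      unfolding H_def using clamp_square_error[of "norm (fst z - fst z')" D "G (snd z) (snd z')"]
      by (subst ennreal_mult[symmetric]) (auto intro!: ennreal_leI)
  qed
  also have "\<dots> = (\<integral>\<^sup>+z. ennreal ((2 * D)\<^sup>2) *
      (\<integral>\<^sup>+z'. ennreal ((norm (fst z - fst z') - G (snd z) (snd z'))\<^sup>2) \<partial>\<pi>) \<partial>\<pi>)"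
  proof (intro nn_integral_cong nn_integral_cmult)
    fix z assume "z \<in> space \<pi>"
    then show "(\<lambda>z'. ennreal ((norm (fst z - fst z') - G (snd z) (snd z'))\<^sup>2)) \<in> borel_measurable \<pi>"
      using measurable_compose[OF measurable_Pair1' meas] by simp
  qed
  also have "\<dots> = ennreal ((2 * D)\<^sup>2) * ?cost"
    unfolding case_prod_beta
    using borel_measurable_nn_integral[OF meas] by (intro nn_integral_cmult) simp
  finally have "?l * qW n X \<xi> \<le> ennsqrt (ennreal ((2 * D)\<^sup>2) * ?cost)"
    using squared_distance_cost_lower_bound[of H] ennsqrt_mono order_trans by blast
  then have "?l * qW n X \<xi> \<le> ennreal (2 * D) * ennsqrt ?cost"
    using D(1) ennsqrt_cmult[of "2 * D"] by simp
  then have "ennreal (1 / (2 * D)) * (?l * qW n X \<xi>) \<le> ennreal (1 / (2 * D)) * (ennreal (2 * D) * ennsqrt ?cost)"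
    by (rule mult_left_mono) simp
  moreover have "ennreal (1 / (2 * D)) * ?l = ennreal (sqrt (lambda_min (cov_matrix \<xi>)) / D)"
    using D(1) True by (subst ennreal_mult[symmetric]) auto
  moreover have "ennreal (1 / (2 * D)) * ennreal (2 * D) = 1"
    using D(1) by (subst ennreal_mult[symmetric]) auto
  ultimately show ?thesis
    by (simp flip: mult.assoc)
qed

end

section \<open>The quantization bounds\<close>

lemma finite_couplingI:
  assumes "gm_space (top_of_set X, g, \<xi>)" "closed X" "convex X"
    and moment: "(\<integral>\<^sup>+x. ennreal (norm x ^ 4) \<partial>\<xi>) < \<infinity>"
    and "sets \<upsilon> = Pow {1..n}" "\<pi> \<in> couplings \<xi> \<upsilon>"
  shows "finite_coupling X \<xi> n \<upsilon> \<pi>"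
proof -
  have sets: "sets \<xi> = sets (borel_of (top_of_set X))"
    using assms(1) by simp
  have [measurable]: "(\<lambda>x. x) \<in> borel_measurable \<xi>"
    using ident_measurable_borel_of[of X] measurable_cong_sets[OF sets refl] by blast
  have "integrable \<xi> (\<lambda>x. norm x ^ 4)"
    using moment by (intro integrableI_nonneg) auto
  moreover have "prob_space \<xi>"
    using assms(1) by simp
  ultimately show ?thesis
    using assms(2,3,5,6) sets by (intro finite_coupling.intro)
qed

theorem theorem4p3:
  fixes X :: "(real ^ 'd) set"
    and g :: "real ^ 'd \<Rightarrow> real ^ 'd \<Rightarrow> real"
    and \<xi> :: "(real ^ 'd) measure"
    and n :: nat
  assumes "gm_space (top_of_set X, g, \<xi>)"
    and "closed X" and "convex X" and "n \<ge> 1"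
  shows "((\<integral>\<^sup>+x. ennreal ((norm x) ^ 4) \<partial>\<xi>) < \<infinity> \<longrightarrow>
          (AE (x, x') in \<xi> \<Otimes>\<^sub>M \<xi>. g x x' = (norm (x - x'))\<^sup>2) \<longrightarrow>
          qGW n (top_of_set X, g, \<xi>)
            \<ge> ennreal (2 * sqrt (lambda_min (cov_matrix \<xi>))) * qW n X \<xi>)
       \<and> (bounded X \<longrightarrow>
          (AE (x, x') in \<xi> \<Otimes>\<^sub>M \<xi>. g x x' = norm (x - x')) \<longrightarrow>
          qGW n (top_of_set X, g, \<xi>)
            \<ge> ennreal (sqrt (lambda_min (cov_matrix \<xi>)) / diameter X) * qW n X \<xi>)"
proof (intro conjI impI)
  have qGW_ge: "b \<le> qGW n (top_of_set X, g, \<xi>)"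
    if "\<And>G \<upsilon> \<pi>. sets \<upsilon> = Pow {1..n} \<Longrightarrow> \<pi> \<in> couplings \<xi> \<upsilon> \<Longrightarrow>
      b \<le> ennsqrt (\<integral>\<^sup>+(x, y). (\<integral>\<^sup>+(x', y'). ennreal (\<bar>g x x' - G y y'\<bar>\<^sup>2) \<partial>\<pi>) \<partial>\<pi>)" for b
    unfolding qGW_def GM_def using that by (auto intro!: INF_greatest)
  {
    assume moment: "(\<integral>\<^sup>+x. ennreal ((norm x) ^ 4) \<partial>\<xi>) < \<infinity>"
      and gauge: "AE (x, x') in \<xi> \<Otimes>\<^sub>M \<xi>. g x x' = (norm (x - x'))\<^sup>2"
    show "qGW n (top_of_set X, g, \<xi>) \<ge> ennreal (2 * sqrt (lambda_min (cov_matrix \<xi>))) * qW n X \<xi>"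
    proof (rule qGW_ge)
      fix G :: "nat \<Rightarrow> nat \<Rightarrow> real" and \<upsilon> :: "nat measure" and \<pi>
      assume "sets \<upsilon> = Pow {1..n}" "\<pi> \<in> couplings \<xi> \<upsilon>"
      then interpret finite_coupling X \<xi> n \<upsilon> \<pi>
        using finite_couplingI[OF assms(1-3) moment] by blast
      show "ennreal (2 * sqrt (lambda_min (cov_matrix \<xi>))) * qW n X \<xi>
          \<le> ennsqrt (\<integral>\<^sup>+(x, y). (\<integral>\<^sup>+(x', y'). ennreal (\<bar>g x x' - G y y'\<bar>\<^sup>2) \<partial>\<pi>) \<partial>\<pi>)"
        unfolding nn_integral_cong_pair_AE[OF gauge, of "\<lambda>t y y'. ennreal (\<bar>t - G y y'\<bar>\<^sup>2)"]
        using squared_distance_cost_lower_bound by simp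
    qed
  }
  {
    assume bounded: "bounded X"
      and gauge: "AE (x, x') in \<xi> \<Otimes>\<^sub>M \<xi>. g x x' = norm (x - x')"
    have diameter: "norm (x - x') \<le> diameter X" if "x \<in> X" "x' \<in> X" for x x'
      using diameter_bounded_bound[OF bounded that] by (simp add: dist_norm)
    obtain R where R: "\<And>x. x \<in> X \<Longrightarrow> norm x \<le> R"
      using bounded by (auto simp: bounded_iff)
    interpret law: prob_space \<xi>
      using assms(1) by simp
    have "space \<xi> = X"
      using assms(1) by (metis gm_space.simps sets_eq_imp_space_eq space_borel_of_subspace)
    then have "(\<integral>\<^sup>+x. ennreal ((norm x) ^ 4) \<partial>\<xi>) \<le> (\<integral>\<^sup>+x. ennreal (R ^ 4) \<partial>\<xi>)"
      using R by (intro nn_integral_mono ennreal_leI power_mono) auto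
    also have "\<dots> < \<infinity>"
      by (simp add: law.emeasure_space_1)
    finally have moment: "(\<integral>\<^sup>+x. ennreal ((norm x) ^ 4) \<partial>\<xi>) < \<infinity>" .
    show "qGW n (top_of_set X, g, \<xi>) \<ge> ennreal (sqrt (lambda_min (cov_matrix \<xi>)) / diameter X) * qW n X \<xi>"
    \<comment> \<open>If \<open>X\<close> is a single point, the factor is \<open>0\<close> because division by zero gives zero.\<close>
    proof (cases "diameter X = 0")
      case False
      then have D: "0 < diameter X"
        using diameter_ge_0[OF bounded] by simp
      show ?thesis
      proof (rule qGW_ge)
        fix G :: "nat \<Rightarrow> nat \<Rightarrow> real" and \<upsilon> :: "nat measure" and \<pi>
        assume "sets \<upsilon> = Pow {1..n}" "\<pi> \<in> couplings \<xi> \<upsilon>"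
        then interpret finite_coupling X \<xi> n \<upsilon> \<pi>
          using finite_couplingI[OF assms(1-3) moment] by blast
        show "ennreal (sqrt (lambda_min (cov_matrix \<xi>)) / diameter X) * qW n X \<xi>
            \<le> ennsqrt (\<integral>\<^sup>+(x, y). (\<integral>\<^sup>+(x', y'). ennreal (\<bar>g x x' - G y y'\<bar>\<^sup>2) \<partial>\<pi>) \<partial>\<pi>)"
          unfolding nn_integral_cong_pair_AE[OF gauge, of "\<lambda>t y y'. ennreal (\<bar>t - G y y'\<bar>\<^sup>2)"]
          using distance_cost_lower_bound[OF D diameter] by simp
      qed
    qed simp
  }
qed

end
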